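(* Let $G$ be a group and $C\subseteq G$. Then the following are equivalent: (1) there is a conjugation quandle over the group $G$ on the set $C$; (2) $C$ is nonempty and closed under conjugation by elements of $\langle C\rangle$; (3) $C$ is a nonempty union of conjugacy classes of the group $\langle C\rangle$.
   Context: A quandle is a nonempty set $Q$ with a binary operation $\star$ such that for each $a\in Q$ one has $a\star a=a$ and the left translation $L_a:Q\to Q$, $x\mapsto a\star x$, is an automorphism of $(Q,\star)$. A conjugation quandle over a group $G$ on a set $C$ is a quandle $(C,\star)$ with $C\subseteq G$ and $a\star b=aba^{-1}$ for all $a,b\in C$. $\langle C\rangle$ denotes the subgroup of $G$ generated by $C$. *)

theory Defs
  imports "HOL-Algebra.Generated_Groups"
begin

text \<open>
  A quandle is given by an explicit carrier \<open>Q\<close> and an operation on the ambient type. Only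
  the values of the operation on \<open>Q\<close> are constrained.
\<close>

definition magma_automorphism ::
    "'a set \<Rightarrow> ('a \<Rightarrow> 'a \<Rightarrow> 'a) \<Rightarrow> ('a \<Rightarrow> 'a) \<Rightarrow> bool" where
  "magma_automorphism Q star f \<longleftrightarrow>
     bij_betw f Q Q \<and> (\<forall>x\<in>Q. \<forall>y\<in>Q. f (star x y) = star (f x) (f y))"

definition quandle :: "'a set \<Rightarrow> ('a \<Rightarrow> 'a \<Rightarrow> 'a) \<Rightarrow> bool" where
  "quandle Q star \<longleftrightarrow>
     Q \<noteq> {} \<and>
     (\<forall>a\<in>Q. \<forall>b\<in>Q. star a b \<in> Q) \<and>
     (\<forall>a\<in>Q. star a a = a \<and> magma_automorphism Q star (\<lambda>x. star a x))"

definition conjugation_quandle ::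
    "('a, 'b) monoid_scheme \<Rightarrow> 'a set \<Rightarrow> ('a \<Rightarrow> 'a \<Rightarrow> 'a) \<Rightarrow> bool" where
  "conjugation_quandle G C star \<longleftrightarrow>
     quandle C star \<and> C \<subseteq> carrier G \<and>
     (\<forall>a\<in>C. \<forall>b\<in>C. star a b = a \<otimes>\<^bsub>G\<^esub> b \<otimes>\<^bsub>G\<^esub> inv\<^bsub>G\<^esub> a)"

definition conjugacy_class :: "('a, 'b) monoid_scheme \<Rightarrow> 'a \<Rightarrow> 'a set" where
  "conjugacy_class G x = {g \<otimes>\<^bsub>G\<^esub> x \<otimes>\<^bsub>G\<^esub> inv\<^bsub>G\<^esub> g | g. g \<in> carrier G}"

definition conjugacy_classes :: "('a, 'b) monoid_scheme \<Rightarrow> 'a set set" where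
  "conjugacy_classes G = conjugacy_class G ` carrier G"

end

theory Submission
  imports Defs
begin

text \<open>Conjugation is an action of the group on itself by automorphisms, so the
  self-distributivity of \<open>a \<otimes> b \<otimes> inv a\<close> is automatic, and so is
  idempotence. The real content of being a quandle on \<open>C\<close> is that every conjugation by
  an element of \<open>C\<close> maps \<open>C\<close> bijectively to itself, that is, that
  \<open>C\<close> is stable under conjugation by its elements and by their inverses. Since these
  generate the subgroup, induction on \<open>generate G C\<close> extends stability to the whole of
  it (\<open>generate_conj_closedI\<close>); conversely, the generators and their inverses lie in
  the subgroup (\<open>conjugation_quandleI\<close>). Finally, conjugacy classes are the orbits of
  this action, and a set is stable exactly when it is a union of orbits
  (\<open>conj_closed_iff_Union_conjugacy_classes\<close>).\<close>

context group
begin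

text \<open>The action law of conjugation. It carries stability from generators to products, and
  with \<open>inv g\<close> as one factor it shows that conjugations by \<open>g\<close> and
  \<open>inv g\<close> undo each other.\<close>

lemma conj_mult:
  assumes "g \<in> carrier G" "h \<in> carrier G" "x \<in> carrier G"
  shows "(g \<otimes> h) \<otimes> x \<otimes> inv (g \<otimes> h) = g \<otimes> (h \<otimes> x \<otimes> inv h) \<otimes> inv g"
  using assms by (simp add: m_assoc inv_mult_group)

lemma conj_inv_conj:
  assumes "g \<in> carrier G" "x \<in> carrier G"
  shows "inv g \<otimes> (g \<otimes> x \<otimes> inv g) \<otimes> g = x"
  using assms conj_mult[of "inv g" g x] by simp

lemma conj_conj_inv:
  assumes "g \<in> carrier G" "x \<in> carrier G"
  shows "g \<otimes> (inv g \<otimes> x \<otimes> g) \<otimes> inv g = x"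
  using assms conj_mult[of g "inv g" x] by simp

lemma conj_distrib:
  assumes "g \<in> carrier G" "x \<in> carrier G" "y \<in> carrier G"
  shows "g \<otimes> (x \<otimes> y) \<otimes> inv g = (g \<otimes> x \<otimes> inv g) \<otimes> (g \<otimes> y \<otimes> inv g)"
proof -
  have "inv g \<otimes> (g \<otimes> (y \<otimes> inv g)) = y \<otimes> inv g"
    using assms by (simp add: m_assoc[symmetric])
  then show ?thesis
    using assms by (simp add: m_assoc)
qed

lemma conj_inv:
  assumes "g \<in> carrier G" "x \<in> carrier G"
  shows "inv (g \<otimes> x \<otimes> inv g) = g \<otimes> inv x \<otimes> inv g"
  using assms by (simp add: m_assoc inv_mult_group)

text \<open>Restricting the carrier keeps the multiplication but changes the term for the inverse;
  in a subgroup both inverses agree, so classes can be computed in \<open>G\<close>.\<close>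

lemma conjugacy_class_subgroup:
  assumes "subgroup H G"
  shows "conjugacy_class (G\<lparr>carrier := H\<rparr>) x = {h \<otimes> x \<otimes> inv h | h. h \<in> H}"
proof -
  have "h \<otimes> x \<otimes> inv\<^bsub>G\<lparr>carrier := H\<rparr>\<^esub> h = h \<otimes> x \<otimes> inv h" if "h \<in> H" for h
    using that by (simp only: m_inv_consistent[OF assms])
  then show ?thesis
    by (auto simp: conjugacy_class_def) (metis (no_types))+
qed

lemma generate_conj_closedI:
  assumes C: "C \<subseteq> carrier G"
    and conj: "\<And>a c. \<lbrakk>a \<in> C; c \<in> C\<rbrakk> \<Longrightarrow> a \<otimes> c \<otimes> inv a \<in> C"
    and inv_conj: "\<And>a c. \<lbrakk>a \<in> C; c \<in> C\<rbrakk> \<Longrightarrow> inv a \<otimes> c \<otimes> a \<in> C"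
    and "h \<in> generate G C" "c \<in> C"
  shows "h \<otimes> c \<otimes> inv h \<in> C"
  \<comment> \<open>\<open>c\<close> must vary: for a product \<open>g \<otimes> h\<close>, the
    hypothesis for \<open>g\<close> is applied to
    \<open>h \<otimes> c \<otimes> inv h\<close>.\<close>
  using assms(4,5)
proof (induction arbitrary: c)
  case one
  then show ?case using C by auto
next
  case (incl a)
  then show ?case by (rule conj)
next
  case (inv a)
  then show ?case using C inv_conj[of a c] by (simp add: subset_iff)
next
  case (eng g h)
  then show ?case
    using C generate_in_carrier[OF C] by (simp add: conj_mult subset_iff)
qed

text \<open>
  As \<open>C\<close> may be infinite, closure under conjugation by inverses needs the surjectivity of the
  left translations; closure of the operation alone does not give it.
\<close>

lemma conjugation_quandle_inv_closed:
  assumes Q: "conjugation_quandle G C star" and a: "a \<in> C" and c: "c \<in> C"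
  shows "inv a \<otimes> c \<otimes> a \<in> C"
proof -
  have "(\<lambda>x. star a x) ` C = C"
    using Q a unfolding conjugation_quandle_def quandle_def magma_automorphism_def bij_betw_def
    by blast
  then obtain b where "b \<in> C" "c = star a b"
    using c by blast
  then have "b \<in> C" "c = a \<otimes> b \<otimes> inv a" "a \<in> carrier G" "b \<in> carrier G"
    using Q a by (auto simp: conjugation_quandle_def)
  then show ?thesis
    by (simp only: conj_inv_conj)
qed

lemma conjugation_quandle_generate_closed:
  assumes Q: "conjugation_quandle G C star" and "h \<in> generate G C" "c \<in> C"
  shows "h \<otimes> c \<otimes> inv h \<in> C"
proof (rule generate_conj_closedI[OF _ _ _ assms(2,3)])
  show "C \<subseteq> carrier G"
    using Q by (simp add: conjugation_quandle_def)
  show "a \<otimes> c \<otimes> inv a \<in> C" if "a \<in> C" "c \<in> C" for a c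
  proof -
    have "star a c \<in> C" "star a c = a \<otimes> c \<otimes> inv a"
      using Q that unfolding conjugation_quandle_def quandle_def by blast+
    then show ?thesis by simp
  qed
qed (rule conjugation_quandle_inv_closed[OF Q])

text \<open>Each left translation is an inner automorphism of \<open>G\<close> restricted to
  \<open>C\<close>. The two closure hypotheses make it and its inverse map \<open>C\<close> into
  \<open>C\<close>, hence it is a bijection.\<close>

lemma conjugation_quandleI:
  assumes C: "C \<subseteq> carrier G" "C \<noteq> {}"
    and conj: "\<And>a c. \<lbrakk>a \<in> C; c \<in> C\<rbrakk> \<Longrightarrow> a \<otimes> c \<otimes> inv a \<in> C"
    and inv_conj: "\<And>a c. \<lbrakk>a \<in> C; c \<in> C\<rbrakk> \<Longrightarrow> inv a \<otimes> c \<otimes> a \<in> C"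
  shows "conjugation_quandle G C (\<lambda>a b. a \<otimes> b \<otimes> inv a)"
proof -
  have "magma_automorphism C (\<lambda>a b. a \<otimes> b \<otimes> inv a) (\<lambda>x. a \<otimes> x \<otimes> inv a)" if "a \<in> C" for a
    unfolding magma_automorphism_def
  proof (intro conjI ballI)
    have carr: "a \<in> carrier G" "\<And>x. x \<in> C \<Longrightarrow> x \<in> carrier G"
      using C that by auto
    show "bij_betw (\<lambda>x. a \<otimes> x \<otimes> inv a) C C"
      by (rule bij_betw_byWitness[where f' = "\<lambda>x. inv a \<otimes> x \<otimes> a"])
        (auto simp: carr that conj inv_conj conj_inv_conj conj_conj_inv)
    show "a \<otimes> (x \<otimes> y \<otimes> inv x) \<otimes> inv a =
        (a \<otimes> x \<otimes> inv a) \<otimes> (a \<otimes> y \<otimes> inv a) \<otimes> inv (a \<otimes> x \<otimes> inv a)"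
      if "x \<in> C" "y \<in> C" for x y
      \<comment> \<open>Pushing conjugation by \<open>a\<close> through the product and the inverse
        turns both sides into the same product of conjugates.\<close>
      using carr that by (simp only: conj_distrib conj_inv m_closed inv_closed)
  qed
  moreover have "a \<otimes> a \<otimes> inv a = a" if "a \<in> C" for a
    using C that by (simp add: m_assoc subset_iff)
  ultimately show ?thesis
    using C conj by (simp add: conjugation_quandle_def quandle_def)
qed

lemma conj_closed_iff_Union_conjugacy_classes:
  assumes H: "subgroup H G" and C: "C \<subseteq> H"
  shows "(\<forall>h\<in>H. \<forall>c\<in>C. h \<otimes> c \<otimes> inv h \<in> C) \<longleftrightarrow>
    (\<exists>S. S \<subseteq> conjugacy_classes (G\<lparr>carrier := H\<rparr>) \<and> C = \<Union>S)"
proof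
  let ?cl = "conjugacy_class (G\<lparr>carrier := H\<rparr>)"
  assume closed: "\<forall>h\<in>H. \<forall>c\<in>C. h \<otimes> c \<otimes> inv h \<in> C"
  have "c \<in> ?cl c" if "c \<in> C" for c
  proof -
    have "c = \<one> \<otimes> c \<otimes> inv \<one>"
      using that C subgroup.subset[OF H] by auto
    then show ?thesis
      unfolding conjugacy_class_subgroup[OF H] using subgroup.one_closed[OF H] by blast
  qed
  \<comment> \<open>The classes of the elements of \<open>C\<close> cover \<open>C\<close>, and
    closure keeps them inside \<open>C\<close>.\<close>
  then have "C = \<Union>(?cl ` C)"
    using closed by (auto simp: conjugacy_class_subgroup[OF H])
  moreover have "?cl ` C \<subseteq> conjugacy_classes (G\<lparr>carrier := H\<rparr>)"
    using C by (auto simp: conjugacy_classes_def)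
  ultimately show "\<exists>S. S \<subseteq> conjugacy_classes (G\<lparr>carrier := H\<rparr>) \<and> C = \<Union>S"
    by blast
next
  assume "\<exists>S. S \<subseteq> conjugacy_classes (G\<lparr>carrier := H\<rparr>) \<and> C = \<Union>S"
  then obtain S where S: "S \<subseteq> conjugacy_classes (G\<lparr>carrier := H\<rparr>)" and CS: "C = \<Union>S"
    by blast
  show "\<forall>h\<in>H. \<forall>c\<in>C. h \<otimes> c \<otimes> inv h \<in> C"
  proof (intro ballI)
    fix h c
    assume h: "h \<in> H" and "c \<in> C"
    then obtain K where K: "K \<in> S" "c \<in> K"
      using CS by blast
    then obtain x where x: "x \<in> H" "K = {g \<otimes> x \<otimes> inv g | g. g \<in> H}"
      using S by (auto simp: conjugacy_classes_def conjugacy_class_subgroup[OF H])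
    then obtain g where g: "g \<in> H" "c = g \<otimes> x \<otimes> inv g"
      using K by blast
    \<comment> \<open>Conjugating \<open>c\<close> by \<open>h\<close> stays in the orbit of
      \<open>x\<close>, with conjugator \<open>h \<otimes> g\<close>.\<close>
    have "h \<otimes> c \<otimes> inv h = (h \<otimes> g) \<otimes> x \<otimes> inv (h \<otimes> g)"
      using conj_mult g h x subgroup.mem_carrier[OF H] by simp
    then have "h \<otimes> c \<otimes> inv h \<in> K"
      using x g h subgroup.m_closed[OF H] by blast
    then show "h \<otimes> c \<otimes> inv h \<in> C"
      using K CS by blast
  qed
qed

end

theorem theorem3p1:
  fixes G :: "('a, 'b) monoid_scheme" and C :: "'a set"
  assumes "group G" and "C \<subseteq> carrier G"
  shows "((\<exists>star. conjugation_quandle G C star) \<longleftrightarrow>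
            C \<noteq> {} \<and>
            (\<forall>h\<in>generate G C. \<forall>c\<in>C. h \<otimes>\<^bsub>G\<^esub> c \<otimes>\<^bsub>G\<^esub> inv\<^bsub>G\<^esub> h \<in> C))
       \<and> (C \<noteq> {} \<and>
            (\<forall>h\<in>generate G C. \<forall>c\<in>C. h \<otimes>\<^bsub>G\<^esub> c \<otimes>\<^bsub>G\<^esub> inv\<^bsub>G\<^esub> h \<in> C) \<longleftrightarrow>
          C \<noteq> {} \<and>
            (\<exists>S. S \<subseteq> conjugacy_classes (G\<lparr>carrier := generate G C\<rparr>) \<and> C = \<Union>S))"
proof (intro conjI)
  interpret group G by fact
  show "(\<exists>star. conjugation_quandle G C star) \<longleftrightarrow>
      C \<noteq> {} \<and> (\<forall>h\<in>generate G C. \<forall>c\<in>C. h \<otimes>\<^bsub>G\<^esub> c \<otimes>\<^bsub>G\<^esub> inv\<^bsub>G\<^esub> h \<in> C)"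
    (is "_ \<longleftrightarrow> C \<noteq> {} \<and> ?closed")
  proof (intro iffI conjI)
    assume "\<exists>star. conjugation_quandle G C star"
    then obtain star where Q: "conjugation_quandle G C star" ..
    show "C \<noteq> {}"
      using Q by (simp add: conjugation_quandle_def quandle_def)
    show ?closed
      using conjugation_quandle_generate_closed[OF Q] by blast
  next
    assume closed: "C \<noteq> {} \<and> ?closed"
    have "conjugation_quandle G C (\<lambda>a b. a \<otimes>\<^bsub>G\<^esub> b \<otimes>\<^bsub>G\<^esub> inv\<^bsub>G\<^esub> a)"
    proof (rule conjugation_quandleI[OF assms(2)])
      show "C \<noteq> {}"
        using closed by simp
      show "a \<otimes>\<^bsub>G\<^esub> c \<otimes>\<^bsub>G\<^esub> inv\<^bsub>G\<^esub> a \<in> C" if "a \<in> C" "c \<in> C" for a c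
        using closed that generate.incl[of a C G] by simp
      show "inv\<^bsub>G\<^esub> a \<otimes>\<^bsub>G\<^esub> c \<otimes>\<^bsub>G\<^esub> a \<in> C" if "a \<in> C" "c \<in> C" for a c
      proof -
        \<comment> \<open>Closure is used at the element \<open>inv a\<close> of the generated
          subgroup, which leaves a double inverse to remove.\<close>
        have "inv\<^bsub>G\<^esub> a \<otimes>\<^bsub>G\<^esub> c \<otimes>\<^bsub>G\<^esub> inv\<^bsub>G\<^esub> (inv\<^bsub>G\<^esub> a) \<in> C"
          using closed that generate.inv[of a C G] by blast
        moreover have "inv\<^bsub>G\<^esub> (inv\<^bsub>G\<^esub> a) = a"
          using that assms(2) by (intro inv_inv) blast
        ultimately show ?thesis
          by simp
      qed
    qed
    then show "\<exists>star. conjugation_quandle G C star"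
      by blast
  qed
  have "C \<subseteq> generate G C"
    by (blast intro: generate.incl)
  then show "C \<noteq> {} \<and> (\<forall>h\<in>generate G C. \<forall>c\<in>C. h \<otimes>\<^bsub>G\<^esub> c \<otimes>\<^bsub>G\<^esub> inv\<^bsub>G\<^esub> h \<in> C) \<longleftrightarrow>
      C \<noteq> {} \<and> (\<exists>S. S \<subseteq> conjugacy_classes (G\<lparr>carrier := generate G C\<rparr>) \<and> C = \<Union>S)"
    using conj_closed_iff_Union_conjugacy_classes[OF generate_is_subgroup[OF assms(2)]] by simp
qed

end
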